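(* Let $d\geqslant 1$ and $0<\alpha<2$. There exist constants $C_1,C_2>0$ depending only on $\alpha$ and the dimension $d$ such that for all $x\neq y$ in $\mathbb{Z}^d$, $$C_1\,d(x,y)^{-d-\alpha}\leqslant Q_\alpha(x,y)\leqslant C_2\,d(x,y)^{-d-\alpha}.$$
   Context: $\mathbb{Z}^d$ is the integer lattice regarded as a graph, with $x\sim y$ iff $x-y\in\{\pm e_1,\dots,\pm e_d\}$, where $e_i$ are the standard unit vectors; $d(x,y)$ denotes the graph distance (the least number of edges in a path from $x$ to $y$). The graph Laplacian is $\Delta f(x)=\sum_{y\sim x}(f(y)-f(x))$. The heat kernel $p(t,x,y)$ on $\mathbb{Z}^d$ is the kernel of the heat semigroup $e^{t\Delta}$: for each $y$, $(t,x)\mapsto p(t,x,y)$ is the bounded solution of $\partial_t v=\Delta v$ with initial value $1_{\{x=y\}}$. For $x\neq y$, $$Q_\alpha(x,y)=\frac{1}{|\Gamma(-\frac{\alpha}{2})|}\int_0^\infty t^{-1-\frac{\alpha}{2}}p(t,x,y)\,dt.$$ *)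

theory Defs
  imports "HOL-Analysis.Analysis"
begin

definition lattice_adj :: "int ^ 'd::finite \<Rightarrow> int ^ 'd \<Rightarrow> bool" where
  "lattice_adj x y \<longleftrightarrow> (\<exists>i. x - y = axis i 1 \<or> x - y = - axis i 1)"

definition lattice_dist :: "int ^ 'd::finite \<Rightarrow> int ^ 'd \<Rightarrow> nat" where
  "lattice_dist x y = (LEAST n. (x, y) \<in> {(u, v). lattice_adj u v} ^^ n)"

definition laplacian :: "(int ^ 'd::finite \<Rightarrow> real) \<Rightarrow> int ^ 'd \<Rightarrow> real" where
  "laplacian f x = (\<Sum>y\<in>{y. lattice_adj y x}. f y - f x)"

text \<open>
  Time ranges over \<open>t \<ge> 0\<close> (at \<open>t = 0\<close> the derivative is one-sided).  Solutions are extended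
  by \<open>0\<close> to negative times, so that the definite description below, which ranges over functions
  of all real times, can have a unique value.
\<close>

definition bounded_heat_solution ::
    "(int ^ 'd::finite \<Rightarrow> real) \<Rightarrow> (real \<Rightarrow> int ^ 'd \<Rightarrow> real) \<Rightarrow> bool" where
  "bounded_heat_solution f v \<longleftrightarrow>
     (\<forall>x. v 0 x = f x) \<and>
     (\<forall>t\<ge>0. \<forall>x. ((\<lambda>s. v s x) has_real_derivative laplacian (v t) x) (at t within {0..})) \<and>
     (\<exists>B. \<forall>t\<ge>0. \<forall>x. \<bar>v t x\<bar> \<le> B) \<and>
     (\<forall>t<0. \<forall>x. v t x = 0)"

definition heat_kernel :: "real \<Rightarrow> int ^ 'd::finite \<Rightarrow> int ^ 'd \<Rightarrow> real" where
  "heat_kernel t x y = (THE v. bounded_heat_solution (\<lambda>z. if z = y then 1 else 0) v) t x"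

text \<open>
  The Bochner integral is \<open>0\<close> for a non-integrable integrand; hence a strictly positive lower
  bound for \<open>Q \<alpha> x y\<close> entails convergence of the integral.
\<close>

definition Q :: "real \<Rightarrow> int ^ 'd::finite \<Rightarrow> int ^ 'd \<Rightarrow> real" where
  "Q \<alpha> x y = 1 / \<bar>Gamma (- (\<alpha> / 2))\<bar> *
     (LINT t:{0<..}|lborel. t powr (- 1 - \<alpha> / 2) * heat_kernel t x y)"

end

(*
  The two-step binomial recursion turns the one-dimensional heat kernel exp(-2t) I_n(2t) into the
  series exp(-4t) * sum_k t^k / k! * (2k choose k+|n|), that is, into a Poisson mixture with mean
  4t of the centred binomial weights. Ratios of neighbouring binomial coefficients give Gaussian
  upper and lower bounds for these weights, and Poisson moments transfer them to the kernel.
  The kernel on the lattice is the product over the coordinates, which is the only bounded solution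
  since the Laplacian is a bounded operator. Writing D for the distance, the product is at most
  a multiple of t D^(-d-2) for t <= D^2 (integrable against t^(-1-alpha/2) because alpha < 2)
  and of t^(-d/2) for t >= D^2, and it is at least a multiple of t^(-d/2) on [4 D^2, 8 D^2].
*)

theory Submission
  imports Defs
begin

section \<open>Centred binomial weights\<close>

text \<open>The law after \<open>k\<close> steps of the lazy walk on the integers that moves by -1,
  0, 1 with probabilities 1/4, 1/2, 1/4; equivalently, the simple walk at time \<open>2 * k\<close>,
  seen on the even sites. Laziness removes the parity obstruction.\<close>

definition cbin :: "nat \<Rightarrow> int \<Rightarrow> real" where
  "cbin k n = real ((2 * k) choose (k + nat \<bar>n\<bar>)) / 4 ^ k"

lemma cbin_nonneg: "0 \<le> cbin k n"
  by (simp add: cbin_def)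

lemma cbin_abs: "cbin k (int (nat \<bar>n\<bar>)) = cbin k n"
  by (simp add: cbin_def)

lemma cbin_le_1: "cbin k n \<le> 1"
proof -
  have "(2 * k) choose (k + nat \<bar>n\<bar>) \<le> 2 ^ (2 * k)"
    by (cases "k + nat \<bar>n\<bar> \<le> 2 * k") (auto simp: binomial_le_pow2 binomial_eq_0)
  then have "real ((2 * k) choose (k + nat \<bar>n\<bar>)) \<le> 4 ^ k"
    by (metis (mono_tags) of_nat_le_iff of_nat_numeral of_nat_power power_mult num_double numeral_times_numeral power2_eq_square)
  then show ?thesis by (simp add: cbin_def)
qed

lemma choose_double_step:
  assumes "1 \<le> j"
  shows "(m + 2) choose (j + 1) = (m choose (j + 1)) + 2 * (m choose j) + (m choose (j - 1))"
  using assms by (cases j) (auto simp: numeral_2_eq_2)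

text \<open>Pascal's rule applied twice is one step of the lazy walk. Through this recursion the
  Poisson series \<open>hk1\<close> solves the heat equation.\<close>

lemma cbin_rec: "4 * cbin (Suc k) n = cbin k (n + 1) + 2 * cbin k n + cbin k (n - 1)"
proof -
  have pos: "4 * cbin (Suc k) (int m) = cbin k (int m + 1) + 2 * cbin k (int m) + cbin k (int m - 1)" for m
  proof (cases m)
    case 0
    show ?thesis
    proof (cases k)
      case 0
      then show ?thesis using \<open>m = 0\<close> by (simp add: cbin_def)
    next
      case (Suc l)
      \<comment> \<open>At the origin both neighbours have absolute value 1, so the coefficient at
        \<open>k - 1\<close> produced by Pascal's rule is reflected to \<open>k + 1\<close>.\<close>
      have "(2 * k) choose (k + 1) = (2 * k) choose (k - 1)"
        using binomial_symmetric[of "k + 1" "2 * k"] Suc by simp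
      with choose_double_step[of k "2 * k"] Suc \<open>m = 0\<close> show ?thesis
        by (simp add: cbin_def field_simps)
    qed
  next
    case (Suc l)
    have e: "nat \<bar>int m + 1\<bar> = m + 1" "nat \<bar>int m - 1\<bar> = m - 1"
      using Suc by auto
    have "(2 * Suc k) choose (Suc k + m) = ((2 * k) choose (k + (m + 1))) + 2 * ((2 * k) choose (k + m)) + ((2 * k) choose (k + (m - 1)))"
      using choose_double_step[of "k + m" "2 * k"] Suc by simp
    then show ?thesis unfolding cbin_def e by (simp add: field_simps)
  qed
  have sym: "cbin j (- i) = cbin j i" for j i by (simp add: cbin_def)
  show ?thesis
  proof (cases "n \<ge> 0")
    case True
    then show ?thesis using pos[of "nat n"] by simp
  next
    case False
    then show ?thesis using pos[of "nat (- n)"] sym[of "Suc k" n] sym[of k n] sym[of k "n + 1"] sym[of k "n - 1"]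
      by (simp add: minus_diff_commute)
  qed
qed

section \<open>Ratios of neighbouring weights and Gaussian bounds\<close>

lemma cbin_Suc:
  assumes "n \<le> k"
  shows "cbin k (int (Suc n)) = cbin k (int n) * (1 - (2 * real n + 1) / (real k + real n + 1))"
proof -
  have "Suc (k + n) * ((2 * k) choose Suc (k + n)) = (2 * k - (k + n)) * ((2 * k) choose (k + n))"
    using binomial_absorption[of "k + n" "2 * k"] binomial_absorb_comp[of "2 * k" "k + n"] by simp
  then have "real (Suc (k + n) * ((2 * k) choose Suc (k + n))) = real ((k - n) * ((2 * k) choose (k + n)))"
    by simp
  then have "(real k + real n + 1) * real ((2 * k) choose Suc (k + n)) = (real k - real n) * real ((2 * k) choose (k + n))"
    using assms by (simp add: algebra_simps)
  then have "real ((2 * k) choose Suc (k + n)) = real ((2 * k) choose (k + n)) * (1 - (2 * real n + 1) / (real k + real n + 1))"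
    by (simp add: field_simps)
  moreover have "nat \<bar>int (Suc n)\<bar> = Suc n" by simp
  ultimately show ?thesis by (simp add: cbin_def)
qed

lemma cbin_0_step: "cbin (Suc k) 0 = cbin k 0 * ((2 * real k + 1) / (2 * real k + 2))"
proof -
  have "cbin k (- 1) = cbin k 1" by (simp add: cbin_def)
  then have "4 * cbin (Suc k) 0 = 2 * cbin k 1 + 2 * cbin k 0"
    using cbin_rec[of k 0] by simp
  moreover have "cbin k 1 = cbin k 0 * (1 - 1 / (real k + 1))"
    using cbin_Suc[of 0 k] by simp
  ultimately have "4 * cbin (Suc k) 0 = cbin k 0 * (2 * (1 - 1 / (real k + 1)) + 2)"
    by (simp add: algebra_simps)
  also have "2 * (1 - 1 / (real k + 1)) + 2 = 4 * ((2 * real k + 1) / (2 * real k + 2))"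
    by (simp add: divide_simps) (simp add: algebra_simps)
  finally show ?thesis by (simp add: field_simps)
qed

text \<open>Squaring keeps square roots out of the induction; the step reduces to (2k+1)(2k+3) \<le>
  (2k+2)^2.\<close>

lemma cbin_0_upper: "(cbin k 0)\<^sup>2 \<le> 1 / (2 * real k + 1)"
proof (induction k)
  case 0
  then show ?case by (simp add: cbin_def)
next
  case (Suc k)
  have "(cbin (Suc k) 0)\<^sup>2 \<le> 1 / (2 * real k + 1) * ((2 * real k + 1) / (2 * real k + 2))\<^sup>2"
    unfolding cbin_0_step power_mult_distrib by (intro mult_right_mono Suc) auto
  also have "\<dots> = (2 * real k + 1) / (2 * real k + 2)\<^sup>2"
    by (simp add: power2_eq_square)
  also have "\<dots> \<le> 1 / (2 * real (Suc k) + 1)"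
    by (simp add: divide_simps) (simp add: power2_eq_square algebra_simps)
  finally show ?case .
qed

text \<open>Equality holds at \<open>k = 1\<close>, and the induction step amounts to 4k(k+1) \<le>
  (2k+1)^2.\<close>

lemma cbin_0_lower: "1 \<le> k \<Longrightarrow> 1 / (4 * real k) \<le> (cbin k 0)\<^sup>2"
proof (induction k rule: nat_induct_at_least)
  case base
  then show ?case by (simp add: cbin_def power2_eq_square)
next
  case (Suc k)
  have "1 / (4 * real (Suc k)) \<le> 1 / (4 * real k) * ((2 * real k + 1) / (2 * real k + 2))\<^sup>2"
    using Suc.hyps by (simp add: divide_simps power2_eq_square) (simp add: algebra_simps)
  also have "\<dots> \<le> (cbin (Suc k) 0)\<^sup>2"
    unfolding cbin_0_step power_mult_distrib by (intro mult_right_mono Suc) auto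
  finally show ?case .
qed

lemma cbin_zero: "k < n \<Longrightarrow> cbin k (int n) = 0"
  by (simp add: cbin_def binomial_eq_0)

text \<open>For n < k the denominator k+n+1 is at most 2k, so each ratio is at most
  exp(-(2n+1)/(2k)); the exponents add up because the first n odd numbers sum to n^2. Beyond
  \<open>k\<close> the weights vanish.\<close>

lemma cbin_gauss_upper: "cbin k (int n) \<le> cbin k 0 * exp (- (real n)\<^sup>2 / (2 * real k))"
proof (induction n)
  case 0
  then show ?case by simp
next
  case (Suc n)
  show ?case
  proof (cases "n < k")
    case True
    have "1 - (2 * real n + 1) / (real k + real n + 1) \<le> 1 - (2 * real n + 1) / (2 * real k)"
      using True by (simp add: frac_le)
    also have "\<dots> \<le> exp (- ((2 * real n + 1) / (2 * real k)))"
      using exp_ge_add_one_self[of "- ((2 * real n + 1) / (2 * real k))"] by simp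
    finally have e: "1 - (2 * real n + 1) / (real k + real n + 1) \<le> exp (- ((2 * real n + 1) / (2 * real k)))" .
    have "cbin k (int (Suc n)) = cbin k (int n) * (1 - (2 * real n + 1) / (real k + real n + 1))"
      using True by (intro cbin_Suc) auto
    also have "\<dots> \<le> (cbin k 0 * exp (- (real n)\<^sup>2 / (2 * real k))) * exp (- ((2 * real n + 1) / (2 * real k)))"
      using True by (intro mult_mono Suc e) (auto simp: cbin_nonneg)
    also have "\<dots> = cbin k 0 * exp (- (real (Suc n))\<^sup>2 / (2 * real k))"
      using True by (simp add: exp_add[symmetric] power2_eq_square field_simps)
    finally show ?thesis .
  next
    case False
    then show ?thesis by (simp only: cbin_zero) (simp add: cbin_nonneg)
  qed
qed

text \<open>A product of factors 1 - a with a in [0,1] is at least 1 minus the sum of the a; here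
  each a is at most (2n+1)/k, and these sum to n^2/k. Past \<open>k\<close> the left side is
  nonpositive.\<close>

lemma cbin_gauss_lower:
  assumes "1 \<le> k"
  shows "cbin k 0 * (1 - (real n)\<^sup>2 / real k) \<le> cbin k (int n)"
proof (induction n)
  case 0
  then show ?case by simp
next
  case (Suc n)
  show ?case
  proof (cases "n < k")
    case True
    let ?a = "(2 * real n + 1) / (real k + real n + 1)" and ?b = "(real n)\<^sup>2 / real k"
    have a: "?a \<le> 1" "?a \<le> (2 * real n + 1) / real k" "0 \<le> ?a" "0 \<le> ?b"
      using True by (auto simp: field_simps)
    have "1 - (real (Suc n))\<^sup>2 / real k = 1 - ?b - (2 * real n + 1) / real k"
      by (simp add: power2_eq_square diff_divide_distrib add_divide_distrib algebra_simps)
    also have "\<dots> \<le> 1 - ?b - ?a" using a by linarith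
    also have "\<dots> \<le> (1 - ?b) * (1 - ?a)"
      using mult_nonneg_nonneg[OF a(3,4)] by (simp only: left_diff_distrib right_diff_distrib) simp
    finally have "cbin k 0 * (1 - (real (Suc n))\<^sup>2 / real k) \<le> cbin k 0 * ((1 - ?b) * (1 - ?a))"
      by (intro mult_left_mono) (auto simp: cbin_nonneg)
    also have "\<dots> = (cbin k 0 * (1 - ?b)) * (1 - ?a)" by simp
    also have "\<dots> \<le> cbin k (int n) * (1 - ?a)"
      using a by (intro mult_right_mono Suc) auto
    also have "\<dots> = cbin k (int (Suc n))"
      using True by (intro cbin_Suc[symmetric]) auto
    finally show ?thesis .
  next
    case False
    then have "real k \<le> (real (Suc n))\<^sup>2"
      using self_le_power[of "real (Suc n)" 2] by simp
    then have "1 - (real (Suc n))\<^sup>2 / real k \<le> 0" using assms by (simp add: field_simps)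
    then show ?thesis
      using cbin_nonneg[of k 0] cbin_nonneg[of k "int (Suc n)"] by (meson mult_nonneg_nonpos order_trans)
  qed
qed

section \<open>The one-dimensional heat kernel\<close>

definition poisson_weight :: "real \<Rightarrow> nat \<Rightarrow> real" where
  "poisson_weight l k = exp (- l) * l ^ k / fact k"

lemma poisson_weight_nonneg: "0 \<le> l \<Longrightarrow> 0 \<le> poisson_weight l k"
  by (simp add: poisson_weight_def)

lemma poisson_weight_sums: "poisson_weight l sums 1"
proof -
  have "(\<lambda>k. exp (- l) * (l ^ k /\<^sub>R fact k)) sums (exp (- l) * exp l)"
    by (intro sums_mult exp_converges)
  then show ?thesis
    by (simp add: poisson_weight_def[abs_def] exp_minus_inverse divide_inverse mult.commute mult.left_commute exp_minus)
qed

text \<open>Cancelling k against k! lowers the index by one, so a factor k inside the expectation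
  becomes a factor \<open>l\<close> outside. Every moment computation below rests on this.\<close>

lemma poisson_weight_shift:
  assumes "(\<lambda>k. poisson_weight l k * f (Suc k)) sums S"
  shows "(\<lambda>k. poisson_weight l k * (real k * f k)) sums (l * S)"
proof -
  have "poisson_weight l (Suc k) * (real (Suc k) * f (Suc k)) = l * (poisson_weight l k * f (Suc k))" for k
    by (simp add: poisson_weight_def divide_simps del: of_nat_Suc)
  then have "(\<lambda>k. poisson_weight l (Suc k) * (real (Suc k) * f (Suc k))) sums (l * S)"
    using sums_mult[OF assms, of l] by (simp only:)
  then show ?thesis by (subst (asm) sums_Suc_iff) simp
qed

text \<open>Induction on \<open>j\<close> by (k+1)^(j+1) = (k+1)^j + k (k+1)^j: the shift identity
  turns the second term into \<open>l\<close> times the expectation of (k+2)^j, and k+2 \<le> 2(k+1)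
  brings back the induction hypothesis at the cost of 2^j.\<close>

lemma poisson_moment:
  "\<exists>C\<ge>0. \<forall>l\<ge>0. summable (\<lambda>k. poisson_weight l k * (real k + 1) ^ j) \<and>
     (\<Sum>k. poisson_weight l k * (real k + 1) ^ j) \<le> C * (1 + l) ^ j"
proof (induction j)
  case 0
  show ?case using sums_unique[OF poisson_weight_sums] sums_summable[OF poisson_weight_sums]
    by (auto intro!: exI[of _ 1])
next
  case (Suc j)
  then obtain C where C: "C \<ge> 0" and
    sm: "\<And>l. l \<ge> 0 \<Longrightarrow> summable (\<lambda>k. poisson_weight l k * (real k + 1) ^ j)" and
    le: "\<And>l. l \<ge> 0 \<Longrightarrow> (\<Sum>k. poisson_weight l k * (real k + 1) ^ j) \<le> C * (1 + l) ^ j"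
    by blast
  show ?case
  proof (intro exI[of _ "C + 2 ^ j * C"] conjI allI impI)
    show "0 \<le> C + 2 ^ j * C" using C by simp
    fix l :: real assume l: "0 \<le> l"
    let ?w = "poisson_weight l"
    have b: "?w k * (real (Suc k) + 1) ^ j \<le> 2 ^ j * (?w k * (real k + 1) ^ j)" for k
    proof -
      have "(real (Suc k) + 1) ^ j \<le> (2 * (real k + 1)) ^ j" by (intro power_mono) auto
      then have "?w k * (real (Suc k) + 1) ^ j \<le> ?w k * (2 * (real k + 1)) ^ j"
        by (intro mult_left_mono poisson_weight_nonneg l)
      then show ?thesis by (simp only: power_mult_distrib mult_ac)
    qed
    have s2: "summable (\<lambda>k. ?w k * (real (Suc k) + 1) ^ j)"
      by (rule summable_comparison_test'[where g = "\<lambda>k. 2 ^ j * (?w k * (real k + 1) ^ j)" and N = 0])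
         (use b sm[OF l] poisson_weight_nonneg[OF l] in \<open>auto intro!: summable_mult simp: abs_mult\<close>)
    let ?S2 = "\<Sum>k. ?w k * (real (Suc k) + 1) ^ j"
    have "?S2 \<le> (\<Sum>k. 2 ^ j * (?w k * (real k + 1) ^ j))"
      by (intro suminf_le b s2 summable_mult sm l)
    also have "\<dots> = 2 ^ j * (\<Sum>k. ?w k * (real k + 1) ^ j)"
      by (intro suminf_mult sm l)
    also have "\<dots> \<le> 2 ^ j * (C * (1 + l) ^ j)" by (intro mult_left_mono le l) auto
    finally have S2: "?S2 \<le> 2 ^ j * (C * (1 + l) ^ j)" .
    have "(\<lambda>k. ?w k * (real k * (real k + 1) ^ j)) sums (l * ?S2)"
      by (intro poisson_weight_shift summable_sums s2)
    then have "(\<lambda>k. ?w k * (real k + 1) ^ j + ?w k * (real k * (real k + 1) ^ j)) sums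
       ((\<Sum>k. ?w k * (real k + 1) ^ j) + l * ?S2)"
      by (intro sums_add summable_sums sm l)
    then have *: "(\<lambda>k. ?w k * (real k + 1) ^ Suc j) sums ((\<Sum>k. ?w k * (real k + 1) ^ j) + l * ?S2)"
      by (simp add: algebra_simps)
    then show "summable (\<lambda>k. ?w k * (real k + 1) ^ Suc j)" by (rule sums_summable)
    have "(\<Sum>k. ?w k * (real k + 1) ^ j) + l * ?S2 \<le> C * (1 + l) ^ j + l * (2 ^ j * (C * (1 + l) ^ j))"
      by (intro add_mono mult_left_mono le S2 l)
    also have "\<dots> \<le> (1 + l) * (C * (1 + l) ^ j) + (1 + l) * (2 ^ j * (C * (1 + l) ^ j))"
      using l C by (intro add_mono mult_right_mono order_trans[OF _ mult_right_mono[of 1 "1 + l"]]) auto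
    finally show "(\<Sum>k. ?w k * (real k + 1) ^ Suc j) \<le> (C + 2 ^ j * C) * (1 + l) ^ Suc j"
      using sums_unique[OF *] by (simp add: algebra_simps)
  qed
qed

text \<open>Steps at rate 4, each taken in a given direction with probability 1/4, give jump rate 1
  to each neighbour, as in \<open>laplacian\<close>; hence the mean \<open>4 * t\<close>.\<close>

definition hk1 :: "real \<Rightarrow> int \<Rightarrow> real" where
  "hk1 t n = (\<Sum>k. poisson_weight (4 * t) k * cbin k n)"

text \<open>Negative \<open>l\<close> is included, hence the absolute value in the majorant: the
  kernel then extends to negative times and has a two-sided derivative at 0.\<close>

lemma hk1_summable: "summable (\<lambda>k. poisson_weight l k * cbin k n)"
proof (rule summable_comparison_test')
  show "summable (\<lambda>k. exp (- l) * (inverse (fact k) * \<bar>l\<bar> ^ k))"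
    by (intro summable_mult summable_exp)
  show "norm (poisson_weight l k * cbin k n) \<le> exp (- l) * (inverse (fact k) * \<bar>l\<bar> ^ k)" for k
    using cbin_le_1[of k n] cbin_nonneg[of k n]
    by (auto simp: poisson_weight_def abs_mult power_abs divide_inverse mult_ac intro!: mult_left_le_one_le)
qed

lemma hk1_nonneg: "0 \<le> t \<Longrightarrow> 0 \<le> hk1 t n"
  unfolding hk1_def by (intro suminf_nonneg hk1_summable) (auto simp: poisson_weight_nonneg cbin_nonneg)

lemma hk1_0: "hk1 0 n = (if n = 0 then 1 else 0)"
proof -
  have "hk1 0 n = (\<Sum>k\<in>{0}. poisson_weight (4 * 0) k * cbin k n)"
    unfolding hk1_def by (rule suminf_finite) (auto simp: poisson_weight_def)
  then show ?thesis by (simp add: poisson_weight_def cbin_def binomial_eq_0)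
qed

section \<open>Upper bounds for the one-dimensional kernel\<close>

lemma poisson_expectation_inverse_Suc:
  assumes l: "0 \<le> l"
  shows "summable (\<lambda>k. poisson_weight l k * (1 / (real k + 1)))"
    and "(\<Sum>k. poisson_weight l k * (1 / (real k + 1))) \<le> 2 / (1 + l)"
proof -
  let ?w = "poisson_weight l"
  have w: "?w k * (1 / (real k + 1)) \<le> ?w k" for k
    using mult_left_mono[of "1 / (real k + 1)" 1 "?w k"] poisson_weight_nonneg[OF l, of k] by simp
  note ws = poisson_weight_sums[of l]
  show s: "summable (\<lambda>k. ?w k * (1 / (real k + 1)))"
    by (rule summable_comparison_test'[OF sums_summable[OF ws], where N = 0])
       (use w poisson_weight_nonneg[OF l] in \<open>auto simp: abs_mult\<close>)
  let ?S = "\<Sum>k. ?w k * (1 / (real k + 1))"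
  have 1: "?S \<le> 1"
    using suminf_le[OF w s sums_summable[OF ws]] sums_unique[OF ws] by simp
  have "(\<lambda>k. ?w k * (1 / real (Suc k))) sums ?S"
    using summable_sums[OF s] by (simp add: add.commute)
  \<comment> \<open>The factor k * (1/k) is 0 at k = 0 and 1 otherwise, so \<open>l * ?S\<close> is
    at most the total mass 1.\<close>
  then have "(\<lambda>k. ?w k * (real k * (1 / real k))) sums (l * ?S)"
    by (rule poisson_weight_shift[where f = "\<lambda>k. 1 / real k"])
  then have "l * ?S \<le> 1"
    by (rule sums_le[rotated]) (use ws in \<open>auto simp: poisson_weight_nonneg[OF l]\<close>)
  then have "(1 + l) * ?S \<le> 2" using 1 by (simp add: distrib_right)
  then show "?S \<le> 2 / (1 + l)" using l by (simp add: pos_le_divide_eq mult.commute)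
qed

lemma cbin_le_0: "cbin k n \<le> cbin k 0"
proof -
  have "cbin k n \<le> cbin k 0 * exp (- (real (nat \<bar>n\<bar>))\<^sup>2 / (2 * real k))"
    using cbin_gauss_upper[of k "nat \<bar>n\<bar>"] unfolding cbin_abs .
  also have "\<dots> \<le> cbin k 0" by (simp add: mult_left_le cbin_nonneg)
  finally show ?thesis .
qed

text \<open>The central weight is the largest, so bounding it suffices. The inequality 2c \<le> s
  c^2 + 1/s trades the expectation of an inverse square root for that of 1/(k+1), and s = sqrt(1+l)
  makes both resulting terms of order 1/s.\<close>

lemma hk1_on_diagonal:
  assumes t: "0 \<le> t"
  shows "hk1 t n \<le> 2 / sqrt (1 + t)"
proof -
  define l where "l = 4 * t"
  define s where "s = sqrt (1 + l)"
  have l: "0 \<le> l" and s: "s > 0" "s\<^sup>2 = 1 + l" using t by (auto simp: l_def s_def)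
  let ?w = "poisson_weight l"
  let ?g = "\<lambda>k. (s / 2) * (?w k * (1 / (real k + 1))) + ?w k * (1 / (2 * s))"
  have c: "cbin k n \<le> s / 2 * (1 / (real k + 1)) + 1 / (2 * s)" for k
  proof -
    have "2 * cbin k 0 \<le> s * (cbin k 0)\<^sup>2 + 1 / s"
    proof -
      have "0 \<le> (s * cbin k 0 - 1)\<^sup>2 / s" using s by simp
      also have "\<dots> = s * (cbin k 0)\<^sup>2 + 1 / s - 2 * cbin k 0"
        using s by (simp add: power2_eq_square field_simps)
      finally show ?thesis by simp
    qed
    also have "\<dots> \<le> s * (1 / (real k + 1)) + 1 / s"
    proof -
      have "(cbin k 0)\<^sup>2 \<le> 1 / (2 * real k + 1)" by (rule cbin_0_upper)
      also have "\<dots> \<le> 1 / (real k + 1)" by (intro divide_left_mono) auto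
      finally show ?thesis using s by (intro add_right_mono mult_left_mono) auto
    qed
    finally have "cbin k 0 \<le> (s * (1 / (real k + 1)) + 1 / s) / 2" by simp
    also have "\<dots> = s / 2 * (1 / (real k + 1)) + 1 / (2 * s)" by (simp add: add_divide_distrib mult.commute)
    finally show ?thesis using cbin_le_0[of k n] by linarith
  qed
  have g: "?w k * cbin k n \<le> ?g k" for k
    using mult_left_mono[OF c poisson_weight_nonneg[OF l], of k k] by (simp add: algebra_simps)
  have gs: "?g sums ((s / 2) * (\<Sum>k. ?w k * (1 / (real k + 1))) + 1 * (1 / (2 * s)))"
    by (intro sums_add sums_mult sums_mult2 summable_sums poisson_expectation_inverse_Suc poisson_weight_sums l)
  have "hk1 t n = (\<Sum>k. ?w k * cbin k n)" by (simp add: hk1_def l_def)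
  also have "\<dots> \<le> (\<Sum>k. ?g k)"
    by (intro suminf_le g hk1_summable sums_summable[OF gs])
  also have "\<dots> = (s / 2) * (\<Sum>k. ?w k * (1 / (real k + 1))) + 1 / (2 * s)"
    using sums_unique[OF gs] by simp
  also have "\<dots> \<le> (s / 2) * (2 / s\<^sup>2) + 1 / (2 * s)"
    using s poisson_expectation_inverse_Suc(2)[OF l] by (intro add_right_mono mult_left_mono) auto
  also have "\<dots> \<le> 2 / s" using s(1) by (simp add: power2_eq_square field_simps)
  also have "\<dots> \<le> 2 / sqrt (1 + t)"
    unfolding s_def l_def using t by (intro divide_left_mono) auto
  finally show ?thesis .
qed

lemma power_div_fact_le_exp:
  fixes x :: real
  assumes "0 \<le> x"
  shows "x ^ m / fact m \<le> exp x"
proof -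
  have e: "(\<lambda>k. x ^ k / fact k) sums exp x"
    using exp_converges[of x] by (simp add: divide_inverse mult.commute)
  have "(\<Sum>k\<in>{m}. x ^ k / fact k) \<le> (\<Sum>k. x ^ k / fact k)"
    by (rule sum_le_suminf) (use assms sums_summable[OF e] in auto)
  then show ?thesis using sums_unique[OF e] by simp
qed

text \<open>The Gaussian factor in the squared weight is weakened to a power by keeping a single
  term of the exponential series.\<close>

lemma cbin_tail:
  assumes "n \<noteq> 0"
  shows "cbin k n \<le> fact (2 * j + 1) * (real k ^ j / \<bar>real_of_int n\<bar> ^ (2 * j + 1))"
proof (cases "k = 0")
  case True
  then show ?thesis using assms by (simp add: cbin_def binomial_eq_0)
next
  case False
  define m where "m = nat \<bar>n\<bar>"
  define J where "J = 2 * j + 1"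
  define x where "x = (real m)\<^sup>2 / real k"
  define F :: real where "F = fact J"
  have m: "real m > 0" "\<bar>real_of_int n\<bar> = real m" using assms by (auto simp: m_def)
  have x: "x > 0" using m False by (simp add: x_def)
  have F: "1 \<le> F" by (simp add: F_def)
  have "(cbin k n)\<^sup>2 \<le> (cbin k 0 * exp (- (real m)\<^sup>2 / (2 * real k)))\<^sup>2"
    using cbin_gauss_upper[of k m] cbin_nonneg[of k n]
    by (intro power_mono) (auto simp: m_def cbin_def)
  also have "\<dots> = (cbin k 0)\<^sup>2 * exp (- x)"
    by (simp add: power_mult_distrib x_def exp_double[symmetric])
  also have "\<dots> \<le> (1 / real k) * (F / x ^ J)"
  proof (intro mult_mono)
    show "(cbin k 0)\<^sup>2 \<le> 1 / real k"
      by (rule order_trans[OF cbin_0_upper divide_left_mono]) (use False in auto)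
    show "exp (- x) \<le> F / x ^ J"
      using power_div_fact_le_exp[of x J] x
      by (simp add: exp_minus F_def field_simps)
  qed auto
  \<comment> \<open>Since \<open>J\<close> is odd, the 1/k from the central weight leaves an even
    power of k and hence a perfect square; replacing \<open>F\<close> by its square then allows
    taking the root.\<close>
  also have "\<dots> = F * (real k ^ j / real m ^ J)\<^sup>2"
    using False m by (simp add: x_def J_def power_add power_mult power2_eq_square field_simps flip: power_mult_distrib)
  also have "\<dots> \<le> F\<^sup>2 * (real k ^ j / real m ^ J)\<^sup>2"
    using F by (intro mult_right_mono) (auto simp: power2_eq_square)
  also have "\<dots> = (F * (real k ^ j / real m ^ J))\<^sup>2" by (simp only: power_mult_distrib)
  finally have "cbin k n \<le> F * (real k ^ j / real m ^ J)"
    by (rule power2_le_imp_le) (use F in auto)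
  then show ?thesis by (simp add: F_def J_def m)
qed

text \<open>One factor k of \<open>cbin_tail\<close> at \<open>Suc j\<close> is spent on the shift
  identity and produces the factor \<open>t\<close>, which later offsets the singularity of the time
  integral at 0.\<close>

lemma hk1_tail:
  "\<exists>C\<ge>0. \<forall>t\<ge>0. \<forall>n. n \<noteq> 0 \<longrightarrow>
     hk1 t n \<le> C * (t * (1 + t) ^ j / \<bar>real_of_int n\<bar> ^ (2 * j + 3))"
proof -
  obtain C where C: "C \<ge> 0" and
    sm: "\<And>l. l \<ge> 0 \<Longrightarrow> summable (\<lambda>k. poisson_weight l k * (real k + 1) ^ j)" and
    le: "\<And>l. l \<ge> 0 \<Longrightarrow> (\<Sum>k. poisson_weight l k * (real k + 1) ^ j) \<le> C * (1 + l) ^ j"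
    using poisson_moment[of j] by blast
  define F :: real where "F = fact (2 * Suc j + 1)"
  show ?thesis
  \<comment> \<open>\<open>F\<close> comes from \<open>cbin_tail\<close>, \<open>C\<close> from the
    Poisson moment, the single 4 from l = 4t, and \<open>4 ^ j\<close> from 1 + 4t \<le> 4(1 +
    t).\<close>
  proof (intro exI[of _ "F * 4 * C * 4 ^ j"] conjI allI impI)
    show "0 \<le> F * 4 * C * 4 ^ j" using C by (simp add: F_def)
    fix t :: real and n :: int assume t: "0 \<le> t" and n: "n \<noteq> 0"
    define l where "l = 4 * t"
    have l: "0 \<le> l" using t by (simp add: l_def)
    let ?w = "poisson_weight l" and ?N = "\<bar>real_of_int n\<bar> ^ (2 * j + 3)"
    let ?S = "\<Sum>k. ?w k * (real k + 1) ^ j"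
    have N: "?N > 0" using n by simp
    have "(\<lambda>k. ?w k * real (Suc k) ^ j) sums ?S"
      using summable_sums[OF sm[OF l]] by (simp add: add.commute)
    from sums_mult[OF poisson_weight_shift[OF this], of "F / ?N"]
    have s: "(\<lambda>k. F / ?N * (?w k * (real k * real k ^ j))) sums (F / ?N * (l * ?S))" .
    have "hk1 t n = (\<Sum>k. ?w k * cbin k n)" by (simp add: hk1_def l_def)
    also have "\<dots> \<le> (\<Sum>k. F / ?N * (?w k * (real k * real k ^ j)))"
    proof (intro suminf_le hk1_summable sums_summable[OF s])
      fix k
      have "cbin k n \<le> F * (real k ^ Suc j / \<bar>real_of_int n\<bar> ^ (2 * Suc j + 1))"
        unfolding F_def by (rule cbin_tail[OF n])
      also have "2 * Suc j + 1 = 2 * j + 3" by simp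
      finally have "?w k * cbin k n \<le> ?w k * (F * (real k ^ Suc j / ?N))"
        by (intro mult_left_mono poisson_weight_nonneg l)
      then show "?w k * cbin k n \<le> F / ?N * (?w k * (real k * real k ^ j))"
        by (simp add: field_simps)
    qed
    also have "\<dots> = F / ?N * (l * ?S)" using sums_unique[OF s] by simp
    also have "\<dots> \<le> F / ?N * (l * (C * (4 * (1 + t)) ^ j))"
    proof -
      have "?S \<le> C * (1 + l) ^ j" by (rule le[OF l])
      also have "\<dots> \<le> C * (4 * (1 + t)) ^ j"
        using C t by (intro mult_left_mono power_mono) (auto simp: l_def)
      finally show ?thesis using N l by (intro mult_left_mono) (auto simp: F_def)
    qed
    also have "\<dots> = F * 4 * C * 4 ^ j * (t * (1 + t) ^ j / ?N)"
      by (simp only: l_def power_mult_distrib) simp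
    finally show "hk1 t n \<le> F * 4 * C * 4 ^ j * (t * (1 + t) ^ j / ?N)" .
  qed
qed

section \<open>Lower bound for the one-dimensional kernel at large times\<close>

lemma poisson_variance: "(\<lambda>k. poisson_weight l k * (real k - l)\<^sup>2) sums l"
proof -
  let ?w = "poisson_weight l"
  have 1: "(\<lambda>k. ?w k * real k) sums l"
    using poisson_weight_shift[of l "\<lambda>_. 1" 1] poisson_weight_sums by simp
  then have "(\<lambda>k. ?w k * real (Suc k)) sums (1 + l)"
    using sums_add[OF poisson_weight_sums 1] by (simp add: algebra_simps)
  from poisson_weight_shift[OF this]
  have 2: "(\<lambda>k. ?w k * (real k * real k)) sums (l * (1 + l))" .
  have "(\<lambda>k. ?w k * (real k * real k) - 2 * l * (?w k * real k) + l\<^sup>2 * ?w k) sums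
     (l * (1 + l) - 2 * l * l + l\<^sup>2 * 1)"
    by (intro sums_add sums_diff sums_mult 1 2 poisson_weight_sums)
  then show ?thesis by (simp add: power2_eq_square algebra_simps)
qed

text \<open>Chebyshev: the Poisson weights concentrate on indices comparable to \<open>4 * t\<close>, where the
  binomial weights are of order \<open>1 / sqrt t\<close>; off this window the quadratic minorant is negative.\<close>

lemma hk1_lower:
  assumes D: "1 \<le> D" and n: "\<bar>real_of_int n\<bar> \<le> D" and t: "4 * D\<^sup>2 \<le> t"
  shows "1 / (16 * sqrt t) \<le> hk1 t n"
proof -
  define l where "l = 4 * t"
  have D2: "1 \<le> D\<^sup>2" using D by simp
  have l: "16 * D\<^sup>2 \<le> l" "16 \<le> l" using t D2 by (auto simp: l_def)
  let ?w = "poisson_weight l"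
  \<comment> \<open>On the window l/2 \<le> k \<le> 3l/2 the central weight is at least 1/(3 sqrt l)
    and the quadratic factor of \<open>cbin_gauss_lower\<close> at least 3/4; \<open>c\<close> is
    the product of the two bounds.\<close>
  define c where "c = 1 / (4 * sqrt l)"
  have c: "c > 0" using l by (simp add: c_def)
  let ?g = "\<lambda>k. c * (1 - 4 / l\<^sup>2 * (real k - l)\<^sup>2)"
  have g: "?g k \<le> cbin k n" for k
  proof (cases "\<bar>real k - l\<bar> \<le> l / 2")
    case False
    then have "l / 2 \<le> \<bar>real k - l\<bar>" by simp
    then have "(l / 2)\<^sup>2 \<le> \<bar>real k - l\<bar>\<^sup>2" using l by (intro power_mono) auto
    then have "1 - 4 / l\<^sup>2 * (real k - l)\<^sup>2 \<le> 0" using l by (simp add: field_simps)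
    then have "?g k \<le> 0" using c by (simp add: mult_nonneg_nonpos)
    then show ?thesis using cbin_nonneg[of k n] by linarith
  next
    case True
    then have k: "l / 2 \<le> real k" "real k \<le> 3 / 2 * l"
      unfolding abs_le_iff by linarith+
    then have k8: "8 * D\<^sup>2 \<le> real k" "8 \<le> real k"
      using l by linarith+
    note k = k k8
    define m where "m = nat \<bar>n\<bar>"
    have m: "real m \<le> D" using n by (simp add: m_def)
    then have "(real m)\<^sup>2 \<le> D\<^sup>2" by (intro power_mono) auto
    then have "(real m)\<^sup>2 / real k \<le> 1 / 8" using k by (simp add: field_simps)
    then have e: "3 / 4 \<le> 1 - (real m)\<^sup>2 / real k" by linarith
    have "(1 / (3 * sqrt l))\<^sup>2 \<le> 1 / (4 * real k)"
      using k l by (simp add: field_simps)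
    also have "\<dots> \<le> (cbin k 0)\<^sup>2" using k by (intro cbin_0_lower) linarith
    finally have "1 / (3 * sqrt l) \<le> cbin k 0"
      by (rule power2_le_imp_le) (rule cbin_nonneg)
    then have "1 / (3 * sqrt l) * (3 / 4) \<le> cbin k 0 * (1 - (real m)\<^sup>2 / real k)"
      using e l by (intro mult_mono) (auto simp: cbin_nonneg)
    also have "\<dots> \<le> cbin k (int m)" using k by (intro cbin_gauss_lower) linarith
    also have "\<dots> = cbin k n" by (simp add: m_def cbin_def)
    finally have "c \<le> cbin k n" by (simp add: c_def)
    moreover have "?g k \<le> c" using c by (simp add: mult_le_cancel_left1)
    ultimately show ?thesis by linarith
  qed
  have "(\<lambda>k. c * (?w k - 4 / l\<^sup>2 * (?w k * (real k - l)\<^sup>2))) sums (c * (1 - 4 / l\<^sup>2 * l))"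
    by (intro sums_mult sums_diff poisson_weight_sums poisson_variance)
  then have s: "(\<lambda>k. ?w k * ?g k) sums (c * (1 - 4 / l\<^sup>2 * l))"
    by (simp add: algebra_simps)
  \<comment> \<open>Here c = 1/(8 sqrt t). By the variance the minorant has mean c (1 - 4/l), and l
    \<ge> 16 leaves more than half of \<open>c\<close>.\<close>
  have "1 / (16 * sqrt t) = c * (1 / 2)" using l by (simp add: c_def l_def real_sqrt_mult)
  also have "\<dots> \<le> c * (1 - 4 / l\<^sup>2 * l)"
    using c l by (intro mult_left_mono) (auto simp: power2_eq_square field_simps)
  also have "\<dots> = (\<Sum>k. ?w k * ?g k)" using sums_unique[OF s] by simp
  also have "\<dots> \<le> (\<Sum>k. ?w k * cbin k n)"
    using l by (intro suminf_le sums_summable[OF s] hk1_summable mult_left_mono g poisson_weight_nonneg) auto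
  also have "\<dots> = hk1 t n" by (simp add: hk1_def l_def)
  finally show ?thesis .
qed

section \<open>The heat equation in one dimension\<close>

lemma hk1_deriv:
  "((\<lambda>t. hk1 t n) has_real_derivative (hk1 t (n + 1) - hk1 t n) + (hk1 t (n - 1) - hk1 t n)) (at t)"
proof -
  \<comment> \<open>Taking out exp(-4t) leaves an everywhere convergent power series with these
    coefficients. Termwise differentiation shifts the index, \<open>cbin_rec\<close> evaluates the
    result, and the -4 from the exponential completes the second difference.\<close>
  define c where "c i k = 4 ^ k * cbin k i / fact k" for i k
  define f where "f i t = (\<Sum>k. c i k * t ^ k)" for i t
  have hk: "poisson_weight (4 * t) k * cbin k i = exp (- (4 * t)) * (c i k * t ^ k)" for t i k
    by (simp add: c_def poisson_weight_def power_mult_distrib)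
  have sm: "summable (\<lambda>k. c i k * t ^ k)" for i t
  proof -
    have "c i k * t ^ k = exp (4 * t) * (poisson_weight (4 * t) k * cbin k i)" for k
      unfolding hk by (simp add: exp_minus)
    then show ?thesis using summable_mult[OF hk1_summable[of "4 * t" i], of "exp (4 * t)"] by simp
  qed
  have hf: "hk1 t i = exp (- (4 * t)) * f i t" for t i
    unfolding hk1_def hk f_def by (intro suminf_mult sm)
  have d: "diffs (c n) k * t ^ k = c (n + 1) k * t ^ k + 2 * (c n k * t ^ k) + c (n - 1) k * t ^ k" for k t
  proof -
    have "diffs (c n) k = 4 ^ k * (4 * cbin (Suc k) n) / fact k"
      by (simp add: diffs_def c_def divide_simps del: of_nat_Suc)
    then have "diffs (c n) k = c (n + 1) k + 2 * c n k + c (n - 1) k"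
      unfolding cbin_rec by (simp add: c_def field_simps)
    then show ?thesis by (simp add: distrib_right)
  qed
  have "(\<lambda>k. diffs (c n) k * t ^ k) sums (f (n + 1) t + 2 * f n t + f (n - 1) t)"
    unfolding d f_def by (intro sums_add sums_mult summable_sums sm)
  then have "(\<Sum>k. diffs (c n) k * t ^ k) = f (n + 1) t + 2 * f n t + f (n - 1) t"
    by (simp add: sums_iff)
  with termdiffs_strong_converges_everywhere[OF sm, of n t]
  have "(f n has_real_derivative f (n + 1) t + 2 * f n t + f (n - 1) t) (at t)"
    by (simp add: f_def[abs_def])
  then show ?thesis unfolding hf[abs_def]
    by (auto intro!: derivative_eq_intros simp: algebra_simps)
qed

section \<open>The heat kernel on the lattice\<close>

text \<open>The neighbours obtained from the signed unit vectors are pairwise distinct, so the sum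
  over the neighbour set reindexes by direction without double counting.\<close>

lemma laplacian_eq:
  fixes x :: "int ^ 'd::finite"
  shows "laplacian f x = (\<Sum>i\<in>UNIV. (f (x + axis i 1) - f x) + (f (x - axis i 1) - f x))"
proof -
  have nb: "{y. lattice_adj y x} = range (\<lambda>i. x + axis i 1) \<union> range (\<lambda>i. x - axis i 1)"
    by (auto simp: lattice_adj_def algebra_simps)
  have ax: "axis i (1::int) \<noteq> - axis j 1" for i j :: 'd
  proof
    assume "axis i (1::int) = - axis j 1"
    then have "axis i (1::int) $ i = (- axis j 1) $ i" by simp
    then show False by (auto simp: axis_def split: if_splits)
  qed
  have disj: "range (\<lambda>i. x + axis i 1) \<inter> range (\<lambda>i. x - axis i 1) = {}"
    using ax by (force simp: diff_conv_add_uminus simp del: add_uminus_conv_diff)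
  have inj: "inj (\<lambda>i. x + axis i 1)" "inj (\<lambda>i. x - axis i 1)"
    by (auto simp: inj_on_def axis_eq_axis)
  show ?thesis
    unfolding laplacian_def nb
    by (simp only: sum.union_disjoint disj sum.reindex inj sum.distrib finite_imageI finite o_def)
qed

section \<open>Graph distance as the l1 norm\<close>

definition l1_norm :: "int ^ 'd::finite \<Rightarrow> nat" where
  "l1_norm x = (\<Sum>i\<in>UNIV. nat \<bar>x $ i\<bar>)"

lemma l1_norm_adj: "lattice_adj x y \<Longrightarrow> l1_norm (x - y) = 1"
proof -
  have "l1_norm (axis i 1 :: int ^ 'a) = 1" for i
  proof -
    have "l1_norm (axis i 1 :: int ^ 'a) = (\<Sum>j\<in>UNIV. if j = i then 1 else 0)"
      unfolding l1_norm_def by (intro sum.cong) (auto simp: axis_def)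
    then show ?thesis by simp
  qed
  moreover have "l1_norm (- z) = l1_norm z" for z :: "int ^ 'a"
    by (simp add: l1_norm_def)
  ultimately show "lattice_adj x y \<Longrightarrow> l1_norm (x - y) = 1"
    by (auto simp: lattice_adj_def)
qed

lemma l1_norm_triangle: "l1_norm (x + y) \<le> l1_norm x + l1_norm y"
  unfolding l1_norm_def sum.distrib[symmetric] by (intro sum_mono) auto

lemma l1_norm_eq_0: "l1_norm x = 0 \<longleftrightarrow> x = 0"
  by (auto simp: l1_norm_def vec_eq_iff)

text \<open>By the triangle inequality a path is at least as long as the norm of the difference of
  its ends; a greedy path, shrinking some nonzero coordinate at each step, attains this
  length.\<close>

lemma lattice_dist_eq: "lattice_dist x y = l1_norm (x - y)"
proof -
  let ?R = "{(u, v). lattice_adj u v} :: ((int ^ 'a) \<times> (int ^ 'a)) set"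
  have lower: "(u, v) \<in> ?R ^^ n \<Longrightarrow> l1_norm (u - v) \<le> n" for u v n
  proof (induction n arbitrary: v)
    case 0
    then show ?case by (simp add: l1_norm_eq_0)
  next
    case (Suc n)
    then obtain z where z: "(u, z) \<in> ?R ^^ n" "lattice_adj z v" by auto
    have "l1_norm (u - v) \<le> l1_norm (u - z) + l1_norm (z - v)"
      using l1_norm_triangle[of "u - z" "z - v"] by simp
    then show ?case using Suc.IH[OF z(1)] l1_norm_adj[OF z(2)] by simp
  qed
  have upper: "l1_norm (u - v) = n \<Longrightarrow> (u, v) \<in> ?R ^^ n" for u v n
  proof (induction n arbitrary: u)
    case 0
    then show ?case by (simp add: l1_norm_eq_0)
  next
    case (Suc n)
    then have "u - v \<noteq> 0" using l1_norm_eq_0[of "u - v"] by auto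
    then obtain i where i: "(u - v) $ i \<noteq> 0" by (auto simp: vec_eq_iff)
    \<comment> \<open>The step carries the sign of the \<open>i\<close>-th coordinate of
      \<open>u - v\<close>, so passing from \<open>u\<close> to \<open>u - e\<close> lowers the norm
      by exactly one.\<close>
    define e where "e = (if (u - v) $ i > 0 then axis i 1 else - axis i 1 :: int ^ 'a)"
    have ei: "e $ j = (if j = i then (if (u - v) $ i > 0 then 1 else -1) else 0)" for j
      by (simp add: e_def axis_def)
    have "l1_norm (u - v) = nat \<bar>(u - v) $ i\<bar> + (\<Sum>j\<in>UNIV - {i}. nat \<bar>(u - v) $ j\<bar>)"
      unfolding l1_norm_def by (rule sum.remove) auto
    moreover have "l1_norm (u - e - v) = nat \<bar>(u - e - v) $ i\<bar> + (\<Sum>j\<in>UNIV - {i}. nat \<bar>(u - e - v) $ j\<bar>)"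
      unfolding l1_norm_def by (rule sum.remove) auto
    moreover have "(\<Sum>j\<in>UNIV - {i}. nat \<bar>(u - e - v) $ j\<bar>) = (\<Sum>j\<in>UNIV - {i}. nat \<bar>(u - v) $ j\<bar>)"
      by (intro sum.cong) (auto simp: ei)
    moreover have "Suc (nat \<bar>(u - e - v) $ i\<bar>) = nat \<bar>(u - v) $ i\<bar>"
      using i by (auto simp: ei)
    ultimately have "l1_norm (u - e - v) = n" using Suc.prems by simp
    then have "(u - e, v) \<in> ?R ^^ n" by (rule Suc.IH)
    moreover have "(u, u - e) \<in> ?R" by (auto simp: lattice_adj_def e_def)
    ultimately show ?case by (rule relpow_Suc_I2[rotated])
  qed
  show ?thesis unfolding lattice_dist_def
    by (rule Least_equality) (use lower upper in auto)
qed

lemma component_le_l1_norm: "nat \<bar>x $ i\<bar> \<le> l1_norm x"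
  unfolding l1_norm_def by (rule member_le_sum) auto

text \<open>The largest coordinate is at least the average. The tail estimate is one-dimensional and
  needs one coordinate comparable to the distance.\<close>

lemma exists_large_component:
  fixes x :: "int ^ 'd::finite"
  obtains i where "l1_norm x \<le> CARD('d) * nat \<bar>x $ i\<bar>"
proof -
  have "\<exists>i. l1_norm x \<le> CARD('d) * nat \<bar>x $ i\<bar>"
  proof -
    define m where "m = Max (range (\<lambda>i. nat \<bar>x $ i\<bar>))"
    have "m \<in> range (\<lambda>i. nat \<bar>x $ i\<bar>)" unfolding m_def by (rule Max_in) auto
    moreover have "l1_norm x \<le> CARD('d) * m"
      unfolding l1_norm_def m_def using sum_bounded_above[of "UNIV :: 'd set" "\<lambda>i. nat \<bar>x $ i\<bar>"] by simp
    ultimately show ?thesis by auto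
  qed
  then show ?thesis using that by blast
qed

section \<open>The product kernel and uniqueness of bounded solutions\<close>

definition hk :: "real \<Rightarrow> int ^ 'd::finite \<Rightarrow> real" where
  "hk t z = (\<Prod>i\<in>UNIV. hk1 t (z $ i))"

lemma hk_deriv:
  fixes x y :: "int ^ 'd::finite"
  shows "((\<lambda>t. hk t (x - y)) has_real_derivative laplacian (\<lambda>z. hk t (z - y)) x) (at t)"
proof -
  let ?z = "x - y"
  let ?P = "\<lambda>i. \<Prod>j\<in>UNIV - {i}. hk1 t (?z $ j)"
  \<comment> \<open>A shift along axis \<open>i\<close> changes only the \<open>i\<close>-th factor,
    so the product rule matches the Laplacian direction by direction.\<close>
  have hk_shift: "hk t (?z + c) = hk1 t (?z $ i + c $ i) * ?P i"
    if c: "\<And>j. j \<noteq> i \<Longrightarrow> c $ j = 0" for i and c :: "int ^ 'd"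
  proof -
    have "hk t (?z + c) = hk1 t ((?z + c) $ i) * (\<Prod>j\<in>UNIV - {i}. hk1 t ((?z + c) $ j))"
      unfolding hk_def by (rule prod.remove) auto
    also have "(\<Prod>j\<in>UNIV - {i}. hk1 t ((?z + c) $ j)) = ?P i"
      using c by (intro prod.cong) auto
    finally show ?thesis by simp
  qed
  have "(\<Sum>i\<in>UNIV. ((hk1 t (?z $ i + 1) - hk1 t (?z $ i)) + (hk1 t (?z $ i - 1) - hk1 t (?z $ i))) * ?P i)
      = (\<Sum>i\<in>UNIV. (hk t (x + axis i 1 - y) - hk t ?z) + (hk t (x - axis i 1 - y) - hk t ?z))"
  proof (rule sum.cong)
    fix i :: 'd
    have "hk t (x + axis i 1 - y) = hk1 t (?z $ i + 1) * ?P i"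
      using hk_shift[of i "axis i 1"] by (simp add: axis_def algebra_simps)
    moreover have "hk t (x - axis i 1 - y) = hk1 t (?z $ i - 1) * ?P i"
      using hk_shift[of i "- axis i 1"] by (simp add: axis_def algebra_simps)
    moreover have "hk t ?z = hk1 t (?z $ i) * ?P i"
      using hk_shift[of i 0] by simp
    ultimately show "((hk1 t (?z $ i + 1) - hk1 t (?z $ i)) + (hk1 t (?z $ i - 1) - hk1 t (?z $ i))) * ?P i
       = (hk t (x + axis i 1 - y) - hk t ?z) + (hk t (x - axis i 1 - y) - hk t ?z)"
      by (simp only: left_diff_distrib distrib_right)
  qed simp
  moreover have "((\<lambda>t. hk t ?z) has_real_derivative
     (\<Sum>i\<in>UNIV. ((hk1 t (?z $ i + 1) - hk1 t (?z $ i)) + (hk1 t (?z $ i - 1) - hk1 t (?z $ i))) * ?P i)) (at t)"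
    unfolding hk_def by (intro has_field_derivative_prod hk1_deriv)
  ultimately show ?thesis unfolding laplacian_eq by simp
qed

lemma hk1_le_2: "0 \<le> t \<Longrightarrow> hk1 t n \<le> 2"
  by (rule order_trans[OF hk1_on_diagonal]) (auto simp: divide_le_eq)

lemma bounded_heat_solution_hk:
  fixes y :: "int ^ 'd::finite"
  shows "bounded_heat_solution (\<lambda>z. if z = y then 1 else 0) (\<lambda>t x. if t < 0 then 0 else hk t (x - y))"
  unfolding bounded_heat_solution_def
proof (intro conjI allI impI)
  show "(if 0 < (0::real) then 0 else hk 0 (x - y)) = (if x = y then 1 else 0)" for x
    by (auto simp: hk_def hk1_0 vec_eq_iff)
  show "((\<lambda>s. if s < 0 then 0 else hk s (x - y)) has_real_derivative
          laplacian (\<lambda>x. if t < 0 then 0 else hk t (x - y)) x) (at t within {0..})"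
    if "0 \<le> t" for t x
  \<comment> \<open>On \<open>{0..}\<close> the truncated function agrees with \<open>hk\<close>, so
    the two-sided derivative restricts to the required one-sided one.\<close>
  proof (rule has_field_derivative_transform_within[where d = 1 and f = "\<lambda>s. hk s (x - y)"])
    show "((\<lambda>s. hk s (x - y)) has_real_derivative
          laplacian (\<lambda>x. if t < 0 then 0 else hk t (x - y)) x) (at t within {0..})"
      using has_field_derivative_at_within[OF hk_deriv] that by (simp add: not_less)
  qed (use that in auto)
  show "\<exists>B. \<forall>t\<ge>0. \<forall>x. \<bar>if t < 0 then 0 else hk t (x - y)\<bar> \<le> B"
  proof (intro exI[of _ "2 ^ CARD('d)"] allI impI)
    fix t :: real and x assume t: "0 \<le> t"
    have "hk t (x - y) \<le> (\<Prod>i\<in>(UNIV::'d set). 2)"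
      unfolding hk_def using t by (intro prod_mono) (auto simp: hk1_nonneg hk1_le_2)
    moreover have "0 \<le> hk t (x - y)"
      unfolding hk_def using t by (intro prod_nonneg) (auto simp: hk1_nonneg)
    ultimately show "\<bar>if t < 0 then 0 else hk t (x - y)\<bar> \<le> 2 ^ CARD('d)"
      using t by simp
  qed
qed auto

text \<open>The Laplacian is bounded on bounded functions, so iterating the mean value bound for the
  difference of two solutions gains a factor of the exponential series at each step.\<close>

lemma heat_difference_bound:
  fixes w :: "real \<Rightarrow> int ^ 'd::finite \<Rightarrow> real"
  assumes w0: "\<And>x. w 0 x = 0"
    and deriv: "\<And>t x. 0 \<le> t \<Longrightarrow> ((\<lambda>s. w s x) has_real_derivative laplacian (w t) x) (at t within {0..})"
    and bound: "\<And>t x. 0 \<le> t \<Longrightarrow> \<bar>w t x\<bar> \<le> M"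
    and t: "0 \<le> t"
  shows "\<bar>w t x\<bar> \<le> M * ((4 * real CARD('d) * t) ^ n / fact n)"
  using t
proof (induction n arbitrary: t x)
  case 0
  then show ?case using bound by simp
next
  case (Suc n)
  \<comment> \<open>\<open>K\<close> bounds the Laplacian in the supremum norm: each direction
    contributes four values.\<close>
  define K where "K = 4 * real CARD('d)"
  let ?\<phi> = "\<lambda>s. M * ((K * s) ^ Suc n / fact (Suc n))"
  let ?\<phi>' = "\<lambda>s. K * (M * ((K * s) ^ n / fact n))"
  show ?case
  proof (cases "t = 0")
    case True
    then show ?thesis using w0 by simp
  next
    case False
    have "norm (w t x - w 0 x) \<le> ?\<phi> t - ?\<phi> 0"
    proof (rule differentiable_bound_general[where f' = "\<lambda>s. laplacian (w s) x" and \<phi>' = ?\<phi>'])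
      show "0 < t" using False Suc.prems by simp
      have "continuous_on {0..} (\<lambda>s. w s x)"
        using deriv by (intro DERIV_continuous_on) auto
      then show "continuous_on {0..t} (\<lambda>s. w s x)" by (rule continuous_on_subset) auto
      show "continuous_on {0..t} ?\<phi>" by (intro continuous_intros) auto
      fix s assume s: "0 < s" "s < t"
      then have "at s within {0..} = at s" by (intro at_within_interior) simp
      then show "((\<lambda>s. w s x) has_vector_derivative laplacian (w s) x) (at s)"
        using deriv[of s x] s by (simp add: has_real_derivative_iff_has_vector_derivative)
      have "(?\<phi> has_real_derivative M * (real (Suc n) * (K * s) ^ n * K / fact (Suc n))) (at s)"
        by (auto intro!: derivative_eq_intros simp del: power_Suc fact_Suc of_nat_Suc)
      also have "M * (real (Suc n) * (K * s) ^ n * K / fact (Suc n)) = ?\<phi>' s"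
        by (simp add: divide_simps del: of_nat_Suc)
      finally show "(?\<phi> has_vector_derivative ?\<phi>' s) (at s)"
        by (simp only: has_real_derivative_iff_has_vector_derivative)
      let ?b = "M * ((K * s) ^ n / fact n)"
      have b: "\<bar>w s z\<bar> \<le> ?b" for z using Suc.IH[of s z] s by (simp add: K_def)
      have "norm (laplacian (w s) x) \<le> (\<Sum>i\<in>(UNIV::'d set). 4 * ?b)"
        unfolding laplacian_eq real_norm_def
      proof (intro order_trans[OF sum_abs] sum_mono)
        fix i :: 'd
        show "\<bar>w s (x + axis i 1) - w s x + (w s (x - axis i 1) - w s x)\<bar> \<le> 4 * ?b"
          using b[of "x + axis i 1"] b[of "x - axis i 1"] b[of x] by linarith
      qed
      then show "norm (laplacian (w s) x) \<le> ?\<phi>' s" by (simp add: K_def mult_ac)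
    qed
    then show ?thesis by (simp add: w0 K_def)
  qed
qed

lemma bounded_heat_solution_unique:
  fixes u v :: "real \<Rightarrow> int ^ 'd::finite \<Rightarrow> real"
  assumes "bounded_heat_solution f u" and "bounded_heat_solution f v"
  shows "u = v"
proof (intro ext)
  fix t :: real and x
  show "u t x = v t x"
  proof (cases "t < 0")
    case True
    then show ?thesis using assms by (simp add: bounded_heat_solution_def)
  next
    case False
    obtain A B where A: "\<And>t x. t \<ge> 0 \<Longrightarrow> \<bar>u t x\<bar> \<le> A" and B: "\<And>t x. t \<ge> 0 \<Longrightarrow> \<bar>v t x\<bar> \<le> B"
      using assms unfolding bounded_heat_solution_def by metis
    let ?w = "\<lambda>t x. u t x - v t x"
    have lap: "laplacian (?w t) x = laplacian (u t) x - laplacian (v t) x" for t x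
      unfolding laplacian_eq sum_subtractf[symmetric] by (intro sum.cong) auto
    have "\<bar>?w t x\<bar> \<le> (A + B) * ((4 * real CARD('d) * t) ^ n / fact n)" for n
    proof (rule heat_difference_bound)
      show "?w 0 x = 0" for x using assms by (simp add: bounded_heat_solution_def)
      show "((\<lambda>s. ?w s x) has_real_derivative laplacian (?w t) x) (at t within {0..})"
        if "0 \<le> t" for t x
        unfolding lap using assms that
        by (intro DERIV_diff) (auto simp: bounded_heat_solution_def)
      show "\<bar>?w t x\<bar> \<le> A + B" if "0 \<le> t" for t x
        using A[OF that, of x] B[OF that, of x] by linarith
    qed (use False in auto)
    \<comment> \<open>The bound holds for every \<open>n\<close> at fixed \<open>t\<close>, and the
      factorial beats the power.\<close>
    moreover have "(\<lambda>n. (4 * real CARD('d) * t) ^ n / fact n) \<longlonglongrightarrow> 0"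
      using summable_LIMSEQ_zero[OF summable_exp[of "4 * real CARD('d) * t"]]
      by (simp add: divide_inverse mult.commute)
    then have "(\<lambda>n. (A + B) * ((4 * real CARD('d) * t) ^ n / fact n)) \<longlonglongrightarrow> (A + B) * 0"
      by (intro tendsto_mult_left)
    ultimately have "\<bar>?w t x\<bar> \<le> (A + B) * 0"
      by (intro LIMSEQ_le_const) auto
    then show ?thesis by simp
  qed
qed

text \<open>Existence together with uniqueness of the bounded solution evaluates the definite
  description.\<close>

lemma heat_kernel_eq: "0 \<le> t \<Longrightarrow> heat_kernel t x y = hk t (x - y)"
proof -
  have "(THE v. bounded_heat_solution (\<lambda>z. if z = y then 1 else 0) v) = (\<lambda>t x. if t < 0 then 0 else hk t (x - y))"
    using bounded_heat_solution_hk bounded_heat_solution_unique by (intro the_equality) blast+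
  then show "0 \<le> t \<Longrightarrow> heat_kernel t x y = hk t (x - y)" by (simp add: heat_kernel_def)
qed

section \<open>Integral bounds\<close>

lemma hk_nonneg: "0 \<le> t \<Longrightarrow> 0 \<le> hk t z"
  unfolding hk_def by (intro prod_nonneg) (auto simp: hk1_nonneg)

lemma sqrt_power_eq_powr:
  assumes "0 < t"
  shows "(1 / sqrt t) ^ n = t powr (- real n / 2)"
proof -
  have "1 / sqrt t = t powr - (1 / 2)"
    using assms by (simp add: powr_minus_divide powr_half_sqrt)
  then show ?thesis using assms by (simp add: powr_power)
qed

lemma hk_far:
  fixes z :: "int ^ 'd::finite"
  assumes "0 < t"
  shows "hk t z \<le> 2 ^ CARD('d) * t powr (- real CARD('d) / 2)"
proof -
  have "hk t z \<le> (\<Prod>i\<in>(UNIV :: 'd set). 2 * (1 / sqrt t))"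
    unfolding hk_def
  proof (intro prod_mono conjI)
    fix i
    have "hk1 t (z $ i) \<le> 2 / sqrt (1 + t)" using assms by (intro hk1_on_diagonal) auto
    also have "\<dots> \<le> 2 * (1 / sqrt t)" using assms by (simp add: frac_le)
    finally show "hk1 t (z $ i) \<le> 2 * (1 / sqrt t)" .
  qed (use assms hk1_nonneg in auto)
  also have "\<dots> = 2 ^ CARD('d) * t powr (- real CARD('d) / 2)"
    using assms by (simp only: prod_constant power_mult_distrib sqrt_power_eq_powr)
  finally show ?thesis .
qed

text \<open>No coordinate exceeds the l1 norm, so \<open>hk1_lower\<close> applies to every factor
  with the same \<open>D\<close>.\<close>

lemma hk_ge:
  fixes z :: "int ^ 'd::finite"
  assumes D: "1 \<le> l1_norm z" and t: "4 * (real (l1_norm z))\<^sup>2 \<le> t"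
  shows "(1 / 16) ^ CARD('d) * t powr (- real CARD('d) / 2) \<le> hk t z"
proof -
  have t0: "0 < t" using D t by (intro less_le_trans[OF _ t]) auto
  have "(1 / 16) ^ CARD('d) * t powr (- real CARD('d) / 2) = (\<Prod>i\<in>(UNIV :: 'd set). (1 / 16) * (1 / sqrt t))"
    using t0 by (simp only: prod_constant power_mult_distrib sqrt_power_eq_powr)
  also have "\<dots> \<le> hk t z"
    unfolding hk_def
  proof (intro prod_mono conjI)
    fix i
    have "\<bar>real_of_int (z $ i)\<bar> \<le> real (l1_norm z)"
      using component_le_l1_norm[of z i] by linarith
    then show "(1 / 16) * (1 / sqrt t) \<le> hk1 t (z $ i)"
      using hk1_lower[of "real (l1_norm z)" "z $ i" t] D t by simp
  qed (use t0 in auto)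
  finally show ?thesis .
qed

text \<open>With s = sqrt(1+t) and j = d-1, a large coordinate contributes t s^(2j) / D^(2j+3) and
  each of the other j coordinates 1/s, up to constants. Since t \<le> D^2 gives s \<le> 2D, the
  remaining s^j costs D^j, and D^j / D^(2j+3) = D^(-d-2).\<close>

lemma hk_near:
  "\<exists>K\<ge>0. \<forall>t\<ge>0. \<forall>z :: int ^ 'd::finite. z \<noteq> 0 \<longrightarrow> t \<le> (real (l1_norm z))\<^sup>2 \<longrightarrow>
     hk t z \<le> K * (t / real (l1_norm z) ^ (CARD('d) + 2))"
proof -
  define d where "d = CARD('d)"
  define j where "j = d - 1"
  have d: "d = Suc j" by (simp add: d_def j_def)
  obtain C where C: "C \<ge> 0" and tail: "\<And>t n. t \<ge> 0 \<Longrightarrow> n \<noteq> 0 \<Longrightarrow>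
     hk1 t n \<le> C * (t * (1 + t) ^ j / \<bar>real_of_int n\<bar> ^ (2 * j + 3))"
    using hk1_tail[of j] by blast
  \<comment> \<open>The power of \<open>d\<close> comes from D \<le> d m for the large coordinate
    \<open>m\<close>, one \<open>2 ^ j\<close> from the factors 2/s and the other from s \<le>
    2D.\<close>
  let ?K = "C * real d ^ (2 * j + 3) * 2 ^ j * 2 ^ j"
  show ?thesis
  proof (intro exI[of _ ?K] conjI allI impI)
    show "0 \<le> ?K" using C by simp
    fix t :: real and z :: "int ^ 'd"
    assume t: "0 \<le> t" and z: "z \<noteq> 0" and tD: "t \<le> (real (l1_norm z))\<^sup>2"
    define D where "D = real (l1_norm z)"
    have D: "1 \<le> D" using z l1_norm_eq_0[of z] by (simp add: D_def)
    define s where "s = sqrt (1 + t)"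
    have s: "1 \<le> s" "s\<^sup>2 = 1 + t" using t by (auto simp: s_def)
    have sD: "s \<le> 2 * D"
    proof -
      have "1 + t \<le> (2 * D)\<^sup>2" using tD D one_le_power[OF D, of 2] by (simp add: D_def power2_eq_square)
      then show ?thesis using D by (auto simp: s_def intro: real_le_lsqrt)
    qed
    obtain i where i: "l1_norm z \<le> d * nat \<bar>z $ i\<bar>"
      using exists_large_component[of z] unfolding d_def by blast
    define m where "m = \<bar>real_of_int (z $ i)\<bar>"
    have zi: "z $ i \<noteq> 0" using i D by (auto simp: D_def)
    then have m: "m > 0" by (simp add: m_def)
    have "D \<le> real (d * nat \<bar>z $ i\<bar>)" unfolding D_def using i by (simp only: of_nat_le_iff)
    then have Dm: "D \<le> real d * m" by (simp add: m_def)
    have "hk t z = hk1 t (z $ i) * (\<Prod>k\<in>UNIV - {i}. hk1 t (z $ k))"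
      unfolding hk_def by (rule prod.remove) auto
    also have "\<dots> \<le> (C * (t * (1 + t) ^ j / m ^ (2 * j + 3))) * (\<Prod>k\<in>UNIV - {i}. 2 / s)"
    proof (intro mult_mono prod_mono conjI prod_nonneg)
      show "hk1 t (z $ i) \<le> C * (t * (1 + t) ^ j / m ^ (2 * j + 3))"
        unfolding m_def by (rule tail[OF t zi])
    qed (use t C m in \<open>auto simp: s_def hk1_nonneg hk1_on_diagonal\<close>)
    also have "(\<Prod>k\<in>UNIV - {i}. 2 / s) = (2 / s) ^ j"
      by (simp add: j_def d_def card_Diff_singleton)
    also have "(C * (t * (1 + t) ^ j / m ^ (2 * j + 3))) * (2 / s) ^ j
       = C * 2 ^ j * t * s ^ j * (1 / m) ^ (2 * j + 3)"
      using s m by (simp add: s(2)[symmetric] power_divide power2_eq_square power_mult_distrib)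
    also have "\<dots> \<le> C * 2 ^ j * t * (2 * D) ^ j * (real d / D) ^ (2 * j + 3)"
    proof (intro mult_mono power_mono)
      show "1 / m \<le> real d / D" using Dm m D by (simp add: field_simps)
    qed (use C t s sD m D in auto)
    also have "\<dots> = ?K * (t / D ^ (d + 2))"
    proof -
      have "D ^ (2 * j + 3) = D ^ j * D ^ (d + 2)" by (simp add: d mult_2 numeral_3_eq_3 flip: power_add)
      then show ?thesis using D by (simp add: power_mult_distrib power_divide)
    qed
    finally show "hk t z \<le> ?K * (t / real (l1_norm z) ^ (CARD('d) + 2))"
      by (simp only: D_def d_def)
  qed
qed

section \<open>Integration over time\<close>

lemma has_bochner_integral_indicator_mult:
  fixes f :: "real \<Rightarrow> real"
  assumes "(f has_integral I) S" and "\<And>x. x \<in> S \<Longrightarrow> 0 \<le> f x"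
    and "f \<in> borel_measurable borel" and "S \<in> sets borel"
  shows "has_bochner_integral lborel (\<lambda>x. indicator S x * f x) I"
proof (rule has_bochner_integral_nn_integral)
  show "0 \<le> I" using assms has_integral_nonneg by blast
  \<comment> \<open>The power integrals used later are gauge integrals; nonnegativity carries their
    values over to the Lebesgue integral.\<close>
  show "(\<integral>\<^sup>+ x. ennreal (indicator S x * f x) \<partial>lborel) = ennreal I"
    using assms by (intro nn_integral_has_integral_lebesgue)
  show "(\<lambda>x. indicator S x * f x) \<in> borel_measurable lborel" using assms by measurable
  show "AE x in lborel. 0 \<le> indicator S x * f x"
    using assms by (auto simp: indicator_def)
qed

lemma stable_integral_bounds:
  fixes \<alpha> :: real
  assumes \<alpha>: "0 < \<alpha>" "\<alpha> < 2"
  shows "\<exists>K\<^sub>1>0. \<exists>K\<^sub>2>0. \<forall>z :: int ^ 'd::finite. z \<noteq> 0 \<longrightarrow>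
    K\<^sub>1 * real (l1_norm z) powr (- real CARD('d) - \<alpha>)
      \<le> (LINT t:{0<..}|lborel. t powr (- 1 - \<alpha> / 2) * hk t z) \<and>
    (LINT t:{0<..}|lborel. t powr (- 1 - \<alpha> / 2) * hk t z)
      \<le> K\<^sub>2 * real (l1_norm z) powr (- real CARD('d) - \<alpha>)"
proof -
  define d where "d = real CARD('d)"
  have d: "d > 0" by (simp add: d_def)
  obtain K where K: "K \<ge> 0" and near: "\<And>t z :: int ^ 'd. 0 \<le> t \<Longrightarrow> z \<noteq> 0 \<Longrightarrow>
     t \<le> (real (l1_norm z))\<^sup>2 \<Longrightarrow> hk t z \<le> K * (t / real (l1_norm z) ^ (CARD('d) + 2))"
    using hk_near[where 'd = 'd] by blast
  \<comment> \<open>The window from 4 D^2 to 8 D^2 has length 4 D^2, and the lower bound is smallest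
    at its right end; \<open>K1\<close> collects what remains after the powers of \<open>D\<close>
    are split off.\<close>
  define K1 where "K1 = 4 * (8 powr (- 1 - \<alpha> / 2 - d / 2) * (1 / 16) ^ CARD('d))"
  \<comment> \<open>The two terms come from times up to D^2 and beyond D^2. The denominator
    \<open>1 - \<alpha> / 2\<close> is positive because \<alpha> < 2.\<close>
  define K2 where "K2 = K / (1 - \<alpha> / 2) + 2 ^ CARD('d) / (\<alpha> / 2 + d / 2)"
  show ?thesis
  proof (intro exI conjI allI impI)
    show "K1 > 0" by (simp add: K1_def)
    show "K2 > 0" using \<alpha> d K by (auto simp: K2_def intro!: add_nonneg_pos divide_nonneg_pos)
    fix z :: "int ^ 'd" assume z: "z \<noteq> 0"
    define D where "D = real (l1_norm z)"
    have D1: "1 \<le> l1_norm z" using z l1_norm_eq_0[of z] by simp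
    then have D: "1 \<le> D" by (simp add: D_def)
    have D2: "0 < D\<^sup>2" using D by auto
    have sq: "D\<^sup>2 powr e = D powr (2 * e)" for e using D powr_powr[of D 2 e] by simp
    define F where "F t = indicator {0<..} t * (t powr (- 1 - \<alpha> / 2) * hk t z)" for t
    have LF: "(LINT t:{0<..}|lborel. t powr (- 1 - \<alpha> / 2) * hk t z) = integral\<^sup>L lborel F"
      by (simp add: set_lebesgue_integral_def F_def[abs_def])
    \<comment> \<open>Differentiability at every real time, negative ones included, gives continuity
      on the whole line and hence Borel measurability.\<close>
    have "continuous_on UNIV (\<lambda>t. hk t z)"
      using hk_deriv[of z 0] by (intro DERIV_continuous_on) auto
    then have [measurable]: "(\<lambda>t. hk t z) \<in> borel_measurable borel"
      by (rule borel_measurable_continuous_onI)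
    have F_meas: "F \<in> borel_measurable lborel"
      unfolding F_def[abs_def] by measurable
    have F0: "0 \<le> F t" for t by (simp add: F_def hk_nonneg indicator_def)

    \<comment> \<open>The factor \<open>t\<close> of \<open>hk_near\<close> raises the exponent from
      -1-\<alpha>/2 to -\<alpha>/2, integrable at 0. Cutting at D^2 makes both pieces of order
      D^(-d-\<alpha>).\<close>
    let ?G1 = "\<lambda>t. indicator {0..D\<^sup>2} t * t powr (- (\<alpha> / 2))"
    let ?G2 = "\<lambda>t. indicator {D\<^sup>2..} t * t powr (- 1 - \<alpha> / 2 - d / 2)"
    define G where "G t = K / D ^ (CARD('d) + 2) * ?G1 t + 2 ^ CARD('d) * ?G2 t" for t
    have "has_bochner_integral lborel ?G1 ((D\<^sup>2) powr (- (\<alpha> / 2) + 1) / (- (\<alpha> / 2) + 1))"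
      using \<alpha> by (intro has_bochner_integral_indicator_mult has_integral_powr_from_0) auto
    moreover have "has_bochner_integral lborel ?G2
       (- ((D\<^sup>2) powr (- 1 - \<alpha> / 2 - d / 2 + 1)) / (- 1 - \<alpha> / 2 - d / 2 + 1))"
      using \<alpha> d D2 by (intro has_bochner_integral_indicator_mult has_integral_powr_to_inf) auto
    ultimately have "has_bochner_integral lborel G
      (K / D ^ (CARD('d) + 2) * ((D\<^sup>2) powr (- (\<alpha> / 2) + 1) / (- (\<alpha> / 2) + 1))
       + 2 ^ CARD('d) * (- ((D\<^sup>2) powr (- 1 - \<alpha> / 2 - d / 2 + 1)) / (- 1 - \<alpha> / 2 - d / 2 + 1)))"
      unfolding G_def[abs_def] by (intro has_bochner_integral_add has_bochner_integral_mult_right)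
    also have "K / D ^ (CARD('d) + 2) * ((D\<^sup>2) powr (- (\<alpha> / 2) + 1) / (- (\<alpha> / 2) + 1))
       = K / (1 - \<alpha> / 2) * D powr (- d - \<alpha>)"
    proof -
      have "D ^ (CARD('d) + 2) = D powr (d + 2)"
        using D powr_realpow[of D "CARD('d) + 2"] by (simp add: d_def add.commute)
      moreover have "(D\<^sup>2) powr (- (\<alpha> / 2) + 1) = D powr (2 - \<alpha>)"
        unfolding sq by (rule arg_cong[where f = "(powr) D"]) (simp add: field_simps)
      moreover have "D powr (- d - \<alpha>) = D powr (2 - \<alpha>) / D powr (d + 2)"
        unfolding powr_diff[symmetric] by (rule arg_cong[where f = "(powr) D"]) (simp add: field_simps)
      ultimately show ?thesis by (simp only: times_divide_times_eq) (simp add: mult.commute)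
    qed
    also have "2 ^ CARD('d) * (- ((D\<^sup>2) powr (- 1 - \<alpha> / 2 - d / 2 + 1)) / (- 1 - \<alpha> / 2 - d / 2 + 1))
       = 2 ^ CARD('d) / (\<alpha> / 2 + d / 2) * D powr (- d - \<alpha>)"
    proof -
      have "(D\<^sup>2) powr (- 1 - \<alpha> / 2 - d / 2 + 1) = D powr (- d - \<alpha>)"
        unfolding sq by (rule arg_cong[where f = "(powr) D"]) (simp add: field_simps)
      moreover have "- 1 - \<alpha> / 2 - d / 2 + 1 = - (\<alpha> / 2 + d / 2)" by simp
      ultimately show ?thesis by (simp only: minus_divide_divide) simp
    qed
    finally have G: "has_bochner_integral lborel G (K2 * D powr (- d - \<alpha>))"
      by (simp add: K2_def distrib_right)
    have FG: "F t \<le> G t" for t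
    proof (cases "0 < t")
      case False
      then show ?thesis using K D by (auto simp: F_def G_def indicator_def)
    next
      case t: True
      show ?thesis
      proof (cases "t \<le> D\<^sup>2")
        case True
        have "F t = t powr (- 1 - \<alpha> / 2) * hk t z" using t by (simp add: F_def)
        also have "\<dots> \<le> t powr (- 1 - \<alpha> / 2) * (K * (t / D ^ (CARD('d) + 2)))"
          using near[of t z] t True z by (intro mult_left_mono) (auto simp: D_def)
        also have "\<dots> = K / D ^ (CARD('d) + 2) * (t powr (- 1 - \<alpha> / 2) * t powr 1)"
          using t by simp
        also have "\<dots> = K / D ^ (CARD('d) + 2) * ?G1 t"
          using t True by (simp only: powr_add[symmetric]) simp
        also have "\<dots> \<le> G t" by (simp add: G_def)
        finally show ?thesis .
      next
        case False
        have "F t = t powr (- 1 - \<alpha> / 2) * hk t z" using t by (simp add: F_def)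
        also have "\<dots> \<le> t powr (- 1 - \<alpha> / 2) * (2 ^ CARD('d) * t powr (- d / 2))"
          unfolding d_def by (intro mult_left_mono hk_far t) auto
        also have "\<dots> = 2 ^ CARD('d) * (t powr (- 1 - \<alpha> / 2) * t powr (- d / 2))" by simp
        also have "\<dots> = 2 ^ CARD('d) * ?G2 t"
          using False by (simp only: powr_add[symmetric]) simp
        also have "\<dots> \<le> G t" using K D by (simp add: G_def)
        finally show ?thesis .
      qed
    qed
    \<comment> \<open>Convergence has to be settled before either comparison: the integral of a
      non-integrable function is 0 by convention.\<close>
    have F_int: "integrable lborel F"
      by (rule Bochner_Integration.integrable_bound[OF integrable.intros[OF G] F_meas])
         (use FG F0 in \<open>auto simp: abs_of_nonneg intro!: AE_I2 order_trans[OF _ abs_ge_self]\<close>)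
    have "integral\<^sup>L lborel F \<le> integral\<^sup>L lborel G"
      using G FG by (intro integral_mono F_int) (auto simp: has_bochner_integral_iff)
    then show "(LINT t:{0<..}|lborel. t powr (- 1 - \<alpha> / 2) * hk t z)
      \<le> K2 * real (l1_norm z) powr (- real CARD('d) - \<alpha>)"
      using G by (simp add: LF has_bochner_integral_iff D_def d_def)

    let ?c = "(8 * D\<^sup>2) powr (- 1 - \<alpha> / 2 - d / 2) * (1 / 16) ^ CARD('d)"
    let ?H = "\<lambda>t. indicator {4 * D\<^sup>2..8 * D\<^sup>2} t * ?c"
    have H: "has_bochner_integral lborel ?H (4 * D\<^sup>2 * ?c)"
    proof -
      have "has_bochner_integral lborel (indicator {4 * D\<^sup>2..8 * D\<^sup>2} :: real \<Rightarrow> real)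
          (measure lborel {4 * D\<^sup>2..8 * D\<^sup>2})"
        by (rule has_bochner_integral_real_indicator) auto
      from has_bochner_integral_mult_left[of ?c, OF this] show ?thesis by simp
    qed
    have HF: "?H t \<le> F t" for t
    proof (cases "t \<in> {4 * D\<^sup>2..8 * D\<^sup>2}")
      case False
      then show ?thesis using F0 by simp
    next
      case True
      have t: "0 < t" by (rule less_le_trans[of _ "4 * D\<^sup>2"]) (use D2 True in auto)
      have "?H t = ?c" using True by simp
      also have "\<dots> \<le> t powr (- 1 - \<alpha> / 2 - d / 2) * (1 / 16) ^ CARD('d)"
        using True t \<alpha> d by (intro mult_right_mono powr_mono2') auto
      also have "\<dots> = t powr (- 1 - \<alpha> / 2) * ((1 / 16) ^ CARD('d) * t powr (- d / 2))"
      proof -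
        have "t powr (- 1 - \<alpha> / 2 - d / 2) = t powr (- 1 - \<alpha> / 2) * t powr (- d / 2)"
          by (simp add: powr_add[symmetric])
        then show ?thesis by simp
      qed
      also have "\<dots> \<le> t powr (- 1 - \<alpha> / 2) * hk t z"
        unfolding d_def using True D1 by (intro mult_left_mono hk_ge) (auto simp: D_def)
      also have "\<dots> = F t" using t by (simp add: F_def)
      finally show ?thesis .
    qed
    have "K1 * D powr (- d - \<alpha>) = 4 * D\<^sup>2 * ?c"
    proof -
      have "(8 * D\<^sup>2) powr (- 1 - \<alpha> / 2 - d / 2)
         = 8 powr (- 1 - \<alpha> / 2 - d / 2) * D powr (- 2 - \<alpha> - d)"
      proof -
        have "2 * (- 1 - \<alpha> / 2 - d / 2) = - 2 - \<alpha> - d" by (simp add: field_simps)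
        then show ?thesis using D by (simp add: powr_mult sq)
      qed
      moreover have "D powr (- d - \<alpha>) = D\<^sup>2 * D powr (- 2 - \<alpha> - d)"
      proof -
        have "- d - \<alpha> = 2 + (- 2 - \<alpha> - d)" by simp
        then show ?thesis using D by (simp only: powr_add) simp
      qed
      ultimately show ?thesis by (simp add: K1_def)
    qed
    also have "\<dots> = integral\<^sup>L lborel ?H" using H by (simp only: has_bochner_integral_iff)
    also have "\<dots> \<le> integral\<^sup>L lborel F"
      using H HF by (intro integral_mono F_int) (auto simp: has_bochner_integral_iff)
    finally show "K1 * real (l1_norm z) powr (- real CARD('d) - \<alpha>)
       \<le> (LINT t:{0<..}|lborel. t powr (- 1 - \<alpha> / 2) * hk t z)"
      by (simp add: LF D_def d_def)
  qed
qed

theorem theorem2p4: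
  fixes \<alpha> :: real
  assumes "0 < \<alpha>" and "\<alpha> < 2"
  shows "\<exists>C\<^sub>1>0. \<exists>C\<^sub>2>0. \<forall>x y :: int ^ 'd::finite. x \<noteq> y \<longrightarrow>
           C\<^sub>1 * real (lattice_dist x y) powr (- real CARD('d) - \<alpha>) \<le> Q \<alpha> x y \<and>
           Q \<alpha> x y \<le> C\<^sub>2 * real (lattice_dist x y) powr (- real CARD('d) - \<alpha>)"
proof -
  define c where "c = 1 / \<bar>Gamma (- (\<alpha> / 2))\<bar>"
  \<comment> \<open>The argument lies strictly between -1 and 0, away from the poles, where
    \<open>Gamma\<close> has the default value 0 and \<open>c\<close> would vanish.\<close>
  have "- (\<alpha> / 2) \<notin> \<int>\<^sub>\<le>\<^sub>0"
  proof
    assume "- (\<alpha> / 2) \<in> \<int>\<^sub>\<le>\<^sub>0"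
    then obtain n :: int where "- (\<alpha> / 2) = of_int n" by (elim nonpos_Ints_cases)
    then have "-1 < real_of_int n" "real_of_int n < 0" using assms by linarith+
    then show False by simp
  qed
  then have c: "c > 0" by (simp add: c_def Gamma_eq_zero_iff)
  obtain K1 K2 where K: "K1 > 0" "K2 > 0" and b: "\<And>z :: int ^ 'd. z \<noteq> 0 \<Longrightarrow>
    K1 * real (l1_norm z) powr (- real CARD('d) - \<alpha>)
      \<le> (LINT t:{0<..}|lborel. t powr (- 1 - \<alpha> / 2) * hk t z) \<and>
    (LINT t:{0<..}|lborel. t powr (- 1 - \<alpha> / 2) * hk t z)
      \<le> K2 * real (l1_norm z) powr (- real CARD('d) - \<alpha>)"
    using stable_integral_bounds[OF assms, where 'd = 'd] by blast
  \<comment> \<open>The integral runs over positive times only, where \<open>heat_kernel_eq\<close>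
    applies.\<close>
  have Q: "Q \<alpha> x y = c * (LINT t:{0<..}|lborel. t powr (- 1 - \<alpha> / 2) * hk t (x - y))" for x y :: "int ^ 'd"
    unfolding Q_def c_def
    by (intro arg_cong2[where f = times] refl set_lebesgue_integral_cong) (auto simp: heat_kernel_eq)
  show ?thesis
  proof (intro exI conjI allI impI)
    show "0 < c * K1" "0 < c * K2" using c K by auto
    fix x y :: "int ^ 'd" assume "x \<noteq> y"
    then have "x - y \<noteq> 0" by simp
    note b = b[OF this]
    show "c * K1 * real (lattice_dist x y) powr (- real CARD('d) - \<alpha>) \<le> Q \<alpha> x y"
      unfolding Q lattice_dist_eq mult.assoc using b c by (intro mult_left_mono) auto
    show "Q \<alpha> x y \<le> c * K2 * real (lattice_dist x y) powr (- real CARD('d) - \<alpha>)"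
      unfolding Q lattice_dist_eq mult.assoc using b c by (intro mult_left_mono) auto
  qed
qed

end
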